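(* Suppose the two piezoelectric layers have the same material properties, i.e. $\alpha_1^1=\alpha_1^3$, $\gamma^1=\gamma^3$, $\beta^1=\beta^3$, $\mu^1=\mu^3$, $\rho_1=\rho_3$. Consider the closed-loop system obtained from the system (S) described in the context by setting $g^1\equiv g^3\equiv 0$ and applying the feedback $$V^{\rm T}(t)=\frac{s_3\,\dot p^3(L,t)}{2h_3},\quad V_{\rm B}(t)=\frac{s_1\,\dot p^1(L,t)}{2h_1},\quad M(t)=k_1\dot w_x(L,t),\quad g(t)=-k_2\dot w(L,t),$$ with $s_1,s_3,k_1,k_2>0$. If $$\frac{\zeta^i_+}{\zeta^i_-}=\frac{2n_i-1}{2m_i-1}\quad\text{for some } m_i,n_i\in\mathbb N,\ i=1,3,$$ then the closed-loop system is not strongly stable.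
   Context: Three-layer active constrained layer beam of length $L>0$; layers $1,3$ are piezoelectric, layer $2$ is a compliant layer. A dot denotes $\partial_t$, a subscript $x$ denotes $\partial_x$, superscripts $i$ are layer indices (except on explicit powers such as $h_i^3$ or $(\gamma^i)^2$). Constants: $h_1,h_2,h_3>0$ (thicknesses), $\rho_1,\rho_3>0$ and $\rho_2\ge 0$ (densities), $G_2>0$, and for $i=1,3$: $\alpha_1^i>0$, $\beta^i>0$, $\mu^i>0$, $\gamma^i\neq0$, and $\alpha^i=\alpha_1^i+(\gamma^i)^2\beta^i$. Further $H=\frac{h_1+2h_2+h_3}{2}$, $m=\sum_{i=1}^3\rho_ih_i$, $K_1=\frac{\rho_1h_1^3}{12}+\frac{\rho_3h_3^3}{12}$, $K_2=\frac{\alpha^1h_1^3}{12}+\frac{\alpha^3h_3^3}{12}$, $\kappa(i)=\mathrm{sgn}(i-2)$ (so $\kappa(1)=-1$, $\kappa(3)=1$). System (S), for unknowns $v^1,v^3,p^1,p^3,w$ as functions of $(x,t)\in(0,L)\times(0,\infty)$: for $i=1,3$, $$\rho_ih_i\ddot v^i-\alpha^ih_iv^i_{xx}+\gamma^i\beta^ih_ip^i_{xx}+\kappa(i)G_2\phi^2=0,$$ $$\mu^ih_i\ddot p^i-\beta^ih_ip^i_{xx}+\gamma^i\beta^ih_iv^i_{xx}=0,$$ $$m\ddot w-K_1\ddot w_{xx}+K_2w_{xxxx}-G_2H\phi^2_x=0,\qquad \phi^2=\frac1{h_2}\left(-v^1+v^3+Hw_x\right)$$ (here $\phi^2$ is a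 function with layer index $2$, not a square), with boundary conditions $$v^i(0)=p^i(0)=0,\quad \alpha^ih_iv^i_x(L)-\gamma^i\beta^ih_ip^i_x(L)=g^i(t)\quad (i=1,3),$$ $$\beta^1h_1p^1_x(L)-\gamma^1\beta^1h_1v^1_x(L)=-V_{\rm B}(t),\quad \beta^3h_3p^3_x(L)-\gamma^3\beta^3h_3v^3_x(L)=-V^{\rm T}(t),$$ $$w(0)=w_x(0)=0,\quad K_2w_{xx}(L)=-M(t),\quad K_1\ddot w_x(L)-K_2w_{xxx}(L)+G_2H\phi^2(L)=g(t),$$ and prescribed initial values of $v^1,v^3,p^1,p^3,w$ and their time derivatives. For $i=1,3$, $$\zeta^i_\pm=\frac1{\sqrt2}\sqrt{\frac{(\gamma^i)^2\mu^i}{\alpha_1^i}+\frac{\mu^i}{\beta^i}+\frac{\rho_i}{\alpha_1^i}\pm\sqrt{\left(\frac{(\gamma^i)^2\mu^i}{\alpha_1^i}+\frac{\mu^i}{\beta^i}+\frac{\rho_i}{\alpha_1^i}\right)^2-\frac{4\rho_i\mu^i}{\beta^i\alpha_1^i}}}.$$ The energy of a solution is $$E(t)=\frac12\int_0^L\Big\{\sum_{i=1,3}h_i\big(\rho_i|\dot v^i|^2+\mu^i|\dot p^i|^2+\alpha_1^i|v^i_x|^2+\beta^i|\gamma^iv^i_x-p^i_x|^2\big)+m|\dot w|^2+K_1|\dot w_x|^2+K_2|w_{xx}|^2+G_2h_2|\phi^2|^2\Big\}dx.$$ The closed-loop system is called strongly stable if $E(t)\to0$ as $t\to\infty$ for the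 solutions with arbitrary finite-energy initial data (satisfying the boundary conditions at $x=0$). *)

theory Defs
  imports "HOL-Analysis.Analysis"
begin

text \<open>
  Time-dependent fields are functions \<open>u :: real \<Rightarrow> real \<Rightarrow> real\<close> taking the time first:
  \<open>u t x\<close>, with \<open>t \<ge> 0\<close> and \<open>x \<in> {0..L}\<close>, so that \<open>u t\<close> is a profile on the beam.
  Derivatives are one-sided at the ends of the beam and at time 0.
\<close>

definition D :: "real \<Rightarrow> (real \<Rightarrow> real) \<Rightarrow> real \<Rightarrow> real" where
  "D L f x = vector_derivative f (at x within {0..L})"

definition dt :: "(real \<Rightarrow> real \<Rightarrow> real) \<Rightarrow> real \<Rightarrow> real \<Rightarrow> real" where
  "dt u t x = vector_derivative (\<lambda>s. u s x) (at t within {0..})"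

text \<open>\<open>Ck L k u\<close>: \<open>u\<close> is of class \<open>C\<^sup>k\<close>, jointly in time and space, up to the boundary.\<close>

primrec Ck :: "real \<Rightarrow> nat \<Rightarrow> (real \<Rightarrow> real \<Rightarrow> real) \<Rightarrow> bool" where
  "Ck L 0 u \<longleftrightarrow> continuous_on ({0..} \<times> {0..L}) (\<lambda>(t, x). u t x)"
| "Ck L (Suc k) u \<longleftrightarrow>
     continuous_on ({0..} \<times> {0..L}) (\<lambda>(t, x). u t x) \<and>
     (\<forall>t\<ge>0. \<forall>x\<in>{0..L}. u t differentiable (at x within {0..L}) \<and>
                        (\<lambda>s. u s x) differentiable (at t within {0..})) \<and>
     Ck L k (\<lambda>t. D L (u t)) \<and> Ck L k (dt u)"

definition L2 :: "real \<Rightarrow> (real \<Rightarrow> real) set" where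
  "L2 L = {f. f \<in> borel_measurable (lebesgue_on {0..L}) \<and>
              integrable (lebesgue_on {0..L}) (\<lambda>x. (f x)\<^sup>2)}"

text \<open>
  The Sobolev spaces \<open>{f \<in> H\<^sup>1(0,L). f(0) = 0}\<close> and \<open>{f \<in> H\<^sup>2(0,L). f(0) = f'(0) = 0}\<close>, described
  through their absolutely continuous representatives. For \<open>f\<close> in the first space the
  pointwise derivative \<open>D L f\<close> exists and equals the weak derivative almost everywhere; for \<open>f\<close>
  in the second one \<open>D L f\<close> exists everywhere on \<open>{0..L}\<close> and belongs to the first space.
\<close>

definition H1_left :: "real \<Rightarrow> (real \<Rightarrow> real) set" where
  "H1_left L = {f. \<exists>g\<in>L2 L. \<forall>x\<in>{0..L}. f x = integral {0..x} g}"

definition H2_left :: "real \<Rightarrow> (real \<Rightarrow> real) set" where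
  "H2_left L = {f. \<exists>g\<in>H1_left L. \<forall>x\<in>{0..L}. f x = integral {0..x} g}"

text \<open>
  A state of the beam: displacements and charges together with their velocities. Only the
  layer indices 1 and 3 are used.
\<close>

record state =
  st_v :: "nat \<Rightarrow> real \<Rightarrow> real"
  st_p :: "nat \<Rightarrow> real \<Rightarrow> real"
  st_w :: "real \<Rightarrow> real"
  st_v' :: "nat \<Rightarrow> real \<Rightarrow> real"
  st_p' :: "nat \<Rightarrow> real \<Rightarrow> real"
  st_w' :: "real \<Rightarrow> real"

definition state_diff :: "state \<Rightarrow> state \<Rightarrow> state" where
  "state_diff S T =
     \<lparr> st_v = (\<lambda>i x. st_v S i x - st_v T i x),
       st_p = (\<lambda>i x. st_p S i x - st_p T i x),
       st_w = (\<lambda>x. st_w S x - st_w T x),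
       st_v' = (\<lambda>i x. st_v' S i x - st_v' T i x),
       st_p' = (\<lambda>i x. st_p' S i x - st_p' T i x),
       st_w' = (\<lambda>x. st_w' S x - st_w' T x) \<rparr>"

definition state_at ::
  "(nat \<Rightarrow> real \<Rightarrow> real \<Rightarrow> real) \<Rightarrow> (nat \<Rightarrow> real \<Rightarrow> real \<Rightarrow> real) \<Rightarrow> (real \<Rightarrow> real \<Rightarrow> real) \<Rightarrow> real \<Rightarrow> state"
where
  "state_at v p w t =
     \<lparr> st_v = (\<lambda>i. v i t), st_p = (\<lambda>i. p i t), st_w = w t,
       st_v' = (\<lambda>i. dt (v i) t), st_p' = (\<lambda>i. dt (p i) t), st_w' = dt w t \<rparr>"

definition energy_space :: "real \<Rightarrow> state set" where
  "energy_space L =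
     {S. (\<forall>i\<in>{1,3}. st_v S i \<in> H1_left L \<and> st_p S i \<in> H1_left L \<and>
                   st_v' S i \<in> L2 L \<and> st_p' S i \<in> L2 L) \<and>
         st_w S \<in> H2_left L \<and> st_w' S \<in> H1_left L}"

text \<open>
  The parameters of the beam; a superscript or subscript layer index becomes an argument of
  type \<^typ>\<open>nat\<close>, and \<open>\<alpha>\<^sub>1 i\<close> is the elastic constant written with both indices.
\<close>

locale acl_beam =
  fixes L G\<^sub>2 :: real
    and h \<rho> \<alpha>\<^sub>1 \<beta> \<gamma> \<mu> :: "nat \<Rightarrow> real"
  assumes L_pos: "L > 0"
    and h_pos: "h 1 > 0" "h 2 > 0" "h 3 > 0"
    and \<rho>_pos: "\<rho> 1 > 0" "\<rho> 3 > 0"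
    and \<rho>2_nonneg: "\<rho> 2 \<ge> 0"
    and G\<^sub>2_pos: "G\<^sub>2 > 0"
    and piezo: "\<And>i. i \<in> {1,3} \<Longrightarrow> \<alpha>\<^sub>1 i > 0 \<and> \<beta> i > 0 \<and> \<mu> i > 0 \<and> \<gamma> i \<noteq> 0"
begin

definition \<alpha> :: "nat \<Rightarrow> real" where
  "\<alpha> i = \<alpha>\<^sub>1 i + (\<gamma> i)\<^sup>2 * \<beta> i"

definition H :: real where
  "H = (h 1 + 2 * h 2 + h 3) / 2"

definition m :: real where
  "m = (\<Sum>i=1..3. \<rho> i * h i)"

definition K\<^sub>1 :: real where
  "K\<^sub>1 = \<rho> 1 * h 1 ^ 3 / 12 + \<rho> 3 * h 3 ^ 3 / 12"

definition K\<^sub>2 :: real where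
  "K\<^sub>2 = \<alpha> 1 * h 1 ^ 3 / 12 + \<alpha> 3 * h 3 ^ 3 / 12"

definition \<kappa> :: "nat \<Rightarrow> real" where
  "\<kappa> i = sgn (real i - 2)"

definition \<zeta>_sum :: "nat \<Rightarrow> real" where
  "\<zeta>_sum i = (\<gamma> i)\<^sup>2 * \<mu> i / \<alpha>\<^sub>1 i + \<mu> i / \<beta> i + \<rho> i / \<alpha>\<^sub>1 i"

definition \<zeta>_plus :: "nat \<Rightarrow> real" where
  "\<zeta>_plus i = 1 / sqrt 2 *
     sqrt (\<zeta>_sum i + sqrt ((\<zeta>_sum i)\<^sup>2 - 4 * \<rho> i * \<mu> i / (\<beta> i * \<alpha>\<^sub>1 i)))"

definition \<zeta>_minus :: "nat \<Rightarrow> real" where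
  "\<zeta>_minus i = 1 / sqrt 2 *
     sqrt (\<zeta>_sum i - sqrt ((\<zeta>_sum i)\<^sup>2 - 4 * \<rho> i * \<mu> i / (\<beta> i * \<alpha>\<^sub>1 i)))"

definition \<phi> :: "(nat \<Rightarrow> real \<Rightarrow> real) \<Rightarrow> (real \<Rightarrow> real) \<Rightarrow> real \<Rightarrow> real" where
  "\<phi> v w x = 1 / h 2 * (- v 1 x + v 3 x + H * D L w x)"

text \<open>
  Classical solutions of the open-loop system with inputs \<open>g\<^sup>1, g\<^sup>3, V\<^sub>B, V\<^sup>T, M, g\<close>; in the
  code \<open>gi\<close> is the pair of forces \<open>g\<^sup>i\<close> and \<open>g\<close> is the scalar transverse force.
\<close>

definition solves_system ::
  "(nat \<Rightarrow> real \<Rightarrow> real) \<Rightarrow> (real \<Rightarrow> real) \<Rightarrow> (real \<Rightarrow> real) \<Rightarrow> (real \<Rightarrow> real) \<Rightarrow> (real \<Rightarrow> real) \<Rightarrow>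
   (nat \<Rightarrow> real \<Rightarrow> real \<Rightarrow> real) \<Rightarrow> (nat \<Rightarrow> real \<Rightarrow> real \<Rightarrow> real) \<Rightarrow> (real \<Rightarrow> real \<Rightarrow> real) \<Rightarrow> bool"
where
  "solves_system gi V_B V_T M g v p w \<longleftrightarrow>
     (\<forall>i\<in>{1,3}. Ck L 2 (v i) \<and> Ck L 2 (p i)) \<and> Ck L 4 w \<and>
     (\<forall>t>0. \<forall>x\<in>{0<..<L}.
        (\<forall>i\<in>{1,3}.
           \<rho> i * h i * dt (dt (v i)) t x - \<alpha> i * h i * D L (D L (v i t)) x
             + \<gamma> i * \<beta> i * h i * D L (D L (p i t)) x
             + \<kappa> i * G\<^sub>2 * \<phi> (\<lambda>j. v j t) (w t) x = 0 \<and>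
           \<mu> i * h i * dt (dt (p i)) t x - \<beta> i * h i * D L (D L (p i t)) x
             + \<gamma> i * \<beta> i * h i * D L (D L (v i t)) x = 0) \<and>
        m * dt (dt w) t x - K\<^sub>1 * D L (D L (dt (dt w) t)) x
          + K\<^sub>2 * D L (D L (D L (D L (w t)))) x
          - G\<^sub>2 * H * D L (\<phi> (\<lambda>j. v j t) (w t)) x = 0) \<and>
     (\<forall>t>0.
        (\<forall>i\<in>{1,3}.
           v i t 0 = 0 \<and> p i t 0 = 0 \<and>
           \<alpha> i * h i * D L (v i t) L - \<gamma> i * \<beta> i * h i * D L (p i t) L = gi i t) \<and>
        \<beta> 1 * h 1 * D L (p 1 t) L - \<gamma> 1 * \<beta> 1 * h 1 * D L (v 1 t) L = - V_B t \<and>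
        \<beta> 3 * h 3 * D L (p 3 t) L - \<gamma> 3 * \<beta> 3 * h 3 * D L (v 3 t) L = - V_T t \<and>
        w t 0 = 0 \<and> D L (w t) 0 = 0 \<and>
        K\<^sub>2 * D L (D L (w t)) L = - M t \<and>
        K\<^sub>1 * D L (dt (dt w) t) L - K\<^sub>2 * D L (D L (D L (w t))) L
          + G\<^sub>2 * H * \<phi> (\<lambda>j. v j t) (w t) L = g t)"

definition classical_solution ::
  "(nat \<Rightarrow> real) \<Rightarrow> real \<Rightarrow> real \<Rightarrow>
   (nat \<Rightarrow> real \<Rightarrow> real \<Rightarrow> real) \<Rightarrow> (nat \<Rightarrow> real \<Rightarrow> real \<Rightarrow> real) \<Rightarrow> (real \<Rightarrow> real \<Rightarrow> real) \<Rightarrow> bool"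
where
  "classical_solution s k\<^sub>1 k\<^sub>2 v p w \<longleftrightarrow>
     solves_system
       (\<lambda>i t. 0)
       (\<lambda>t. s 1 * dt (p 1) t L / (2 * h 1))
       (\<lambda>t. s 3 * dt (p 3) t L / (2 * h 3))
       (\<lambda>t. k\<^sub>1 * D L (dt w t) L)
       (\<lambda>t. - k\<^sub>2 * dt w t L)
       v p w"

definition energy :: "state \<Rightarrow> real" where
  "energy S = 1 / 2 * (\<integral>x.
     (\<Sum>i\<in>{1,3}. h i * (\<rho> i * \<bar>st_v' S i x\<bar>\<^sup>2 + \<mu> i * \<bar>st_p' S i x\<bar>\<^sup>2
                      + \<alpha>\<^sub>1 i * \<bar>D L (st_v S i) x\<bar>\<^sup>2
                      + \<beta> i * \<bar>\<gamma> i * D L (st_v S i) x - D L (st_p S i) x\<bar>\<^sup>2))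
     + m * \<bar>st_w' S x\<bar>\<^sup>2 + K\<^sub>1 * \<bar>D L (st_w' S) x\<bar>\<^sup>2 + K\<^sub>2 * \<bar>D L (D L (st_w S)) x\<bar>\<^sup>2
     + G\<^sub>2 * h 2 * \<bar>\<phi> (st_v S) (st_w S) x\<bar>\<^sup>2 \<partial>lebesgue_on {0..L})"

text \<open>
  For data of finite energy only, the traces \<open>p\<^sub>t(L)\<close>, \<open>w\<^sub>x\<^sub>t(L)\<close> and the second derivatives need
  not exist pointwise. As usual, solutions are then the limits of classical solutions
  in the energy norm, uniformly on bounded time intervals (the mild solutions of the
  associated contraction semigroup).
\<close>

definition finite_energy_solution ::
  "(nat \<Rightarrow> real) \<Rightarrow> real \<Rightarrow> real \<Rightarrow> (real \<Rightarrow> state) \<Rightarrow> bool"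
where
  "finite_energy_solution s k\<^sub>1 k\<^sub>2 S \<longleftrightarrow>
     (\<forall>t\<ge>0. S t \<in> energy_space L) \<and>
     (\<exists>v p w. (\<forall>n::nat. classical_solution s k\<^sub>1 k\<^sub>2 (v n) (p n) (w n)) \<and>
        (\<forall>T>0. uniform_limit {0..T}
           (\<lambda>n t. energy (state_diff (S t) (state_at (v n) (p n) (w n) t))) (\<lambda>t. 0)
           sequentially))"

definition strongly_stable :: "(nat \<Rightarrow> real) \<Rightarrow> real \<Rightarrow> real \<Rightarrow> bool" where
  "strongly_stable s k\<^sub>1 k\<^sub>2 \<longleftrightarrow>
     (\<forall>S\<^sub>0\<in>energy_space L. \<forall>S. finite_energy_solution s k\<^sub>1 k\<^sub>2 S \<and> S 0 = S\<^sub>0 \<longrightarrow>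
        ((\<lambda>t. energy (S t)) \<longlongrightarrow> 0) at_top)"

end

end

theory Submission
  imports Defs
begin

text \<open>
  With equal material parameters the two piezoelectric layers can move in unison, \<open>v\<^sup>1 = v\<^sup>3\<close> and
  \<open>p\<^sup>1 = p\<^sup>3\<close>, while the beam does not bend, \<open>w = 0\<close>. The shear \<open>\<phi>\<^sup>2\<close> then vanishes, so the layers
  decouple from the bending, and each layer obeys the same pair of wave equations for
  \<open>(v, p)\<close>. The bending feedback is idle, and the only damping left acts through the trace of
  \<open>\<partial>\<^sub>t p\<close> at \<open>x = L\<close>. An undamped motion is therefore obtained from any standing wave
  \<open>sin (\<omega> t) (V x, P x)\<close> that satisfies the free end conditions \<open>V' L = P' L = 0\<close> and, in addition, \<open>P L = 0\<close>.

  A vector-valued sine wave of wave number \<open>k\<close> solves the pair of wave equations exactly when its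
  frequency is \<open>k / \<zeta>\<^sub>+\<close> or \<open>k / \<zeta>\<^sub>-\<close> and its amplitude is proportional to
  \<open>(\<beta> - \<mu> / \<zeta>\<^sub>\<plusminus>\<^sup>2, \<gamma> \<beta>)\<close>; it satisfies the free end conditions exactly when \<open>k L\<close> is an odd multiple of
  \<open>\<pi> / 2\<close>. The hypothesis on \<open>\<zeta>\<^sub>+ / \<zeta>\<^sub>-\<close> says that one wave of each family can be chosen with the
  same frequency (lemma \<open>common_frequency\<close>). The \<open>p\<close>-amplitudes of the two waves agree, so in
  their difference, with signs normalized at \<open>x = L\<close>, the values of \<open>P\<close> at \<open>L\<close> cancel. The
  \<open>v\<close>-amplitudes differ because \<open>\<zeta>\<^sub>+ \<noteq> \<zeta>\<^sub>-\<close>, hence \<open>V L \<noteq> 0\<close> and the wave is not trivial. Its energy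
  takes the same positive value after every period (lemma \<open>undamped_wave_not_stable\<close>).
\<close>

section \<open>Towers of derivatives and separated fields\<close>

text \<open>A smooth function together with all its derivatives. Working with the whole sequence makes
  every iterated derivative of a separated field explicit.\<close>

definition tower :: "(nat \<Rightarrow> real \<Rightarrow> real) \<Rightarrow> bool" where
  "tower F \<longleftrightarrow> (\<forall>n x. (F n has_real_derivative F (Suc n) x) (at x))"

text \<open>Differentiating a sine shifts its phase by a quarter turn, so one formula covers all the
  derivatives of \<open>sin (k x)\<close>.\<close>

definition sin_tower :: "real \<Rightarrow> nat \<Rightarrow> real \<Rightarrow> real" where
  "sin_tower k n x = k ^ n * sin (k * x + real n * (pi / 2))"

lemma tower_sin: "tower (sin_tower k)"
proof -
  have shift: "sin (k * x + real (Suc n) * (pi / 2)) = cos (k * x + real n * (pi / 2))" for n x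
  proof -
    have "k * x + real (Suc n) * (pi / 2) = k * x + real n * (pi / 2) + pi / 2"
      by (simp add: field_simps)
    then show ?thesis
      by (simp only: sin_add[of "k * x + real n * (pi / 2)"]) simp
  qed
  show ?thesis
    unfolding tower_def sin_tower_def shift by (auto intro!: derivative_eq_intros)
qed

lemma tower_combination:
  assumes "tower F" "tower G"
  shows "tower (\<lambda>n x. a * F n x + b * G n x)"
  using assms unfolding tower_def by (auto intro!: derivative_eq_intros)

lemma tower_continuous: "tower F \<Longrightarrow> continuous_on A (F n)"
  unfolding tower_def by (meson DERIV_isCont continuous_at_imp_continuous_on)

lemma sin_tower_0: "sin_tower k 0 x = sin (k * x)"
  and sin_tower_1: "sin_tower k (Suc 0) x = k * cos (k * x)"
  and sin_tower_2: "sin_tower k (Suc (Suc 0)) x = - k\<^sup>2 * sin (k * x)"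
  by (simp_all add: sin_tower_def sin_add cos_add power2_eq_square)

text \<open>The one-sided derivatives see only the values on the beam, so a derivative that is itself
  only known there can be differentiated again.\<close>

lemma D_eqI:
  assumes "L > 0" "x \<in> {0..L}" and eq: "\<And>y. y \<in> {0..L} \<Longrightarrow> f y = g y"
    and g: "(g has_real_derivative d) (at x)"
  shows "D L f x = d" and "f differentiable (at x within {0..L})"
proof -
  have "(g has_vector_derivative d) (at x within {0..L})"
    using g has_real_derivative_iff_has_vector_derivative has_vector_derivative_at_within by blast
  then have f: "(f has_vector_derivative d) (at x within {0..L})"
    by (rule has_vector_derivative_transform[rotated 2]) (use assms in auto)
  show "D L f x = d"
    unfolding D_def using assms f by (auto intro!: vector_derivative_within_cbox[of 0 L, simplified])
  show "f differentiable (at x within {0..L})"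
    using f differentiableI_vector by blast
qed

lemma dt_eqI:
  assumes "t \<ge> 0" and eq: "\<And>r. r \<ge> 0 \<Longrightarrow> u r x = g r"
    and g: "(g has_real_derivative d) (at t)"
  shows "dt u t x = d" and "(\<lambda>r. u r x) differentiable (at t within {0..})"
proof -
  have "(g has_vector_derivative d) (at t within {0..})"
    using g has_real_derivative_iff_has_vector_derivative has_vector_derivative_at_within by blast
  then have f: "((\<lambda>r. u r x) has_vector_derivative d) (at t within {0..})"
    by (rule has_vector_derivative_transform[rotated 2]) (use assms in auto)
  have "at t within {0..} \<noteq> bot"
  proof
    assume "at t within {0..} = bot"
    moreover have "at_right t \<le> at t within {0..}"
      using assms(1) by (intro at_le) auto
    ultimately show False
      using trivial_limit_at_right_real[of t] by (simp add: bot_unique)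
  qed
  then show "dt u t x = d"
    unfolding dt_def using f vector_derivative_within by blast
  show "(\<lambda>r. u r x) differentiable (at t within {0..})"
    using f differentiableI_vector by blast
qed

lemma D_tower:
  assumes "L > 0" "tower X" "x \<in> {0..L}" and "\<And>y. y \<in> {0..L} \<Longrightarrow> f y = c * X n y"
  shows "D L f x = c * X (Suc n) x" and "f differentiable (at x within {0..L})"
proof -
  have "((\<lambda>y. c * X n y) has_real_derivative c * X (Suc n) x) (at x)"
    using assms(2) unfolding tower_def by (auto intro!: derivative_eq_intros)
  then show "D L f x = c * X (Suc n) x" "f differentiable (at x within {0..L})"
    using D_eqI[where f = f and L = L, OF assms(1,3)] assms(4) by metis+
qed

lemma dt_tower:
  assumes "tower T" "t \<ge> 0" and "\<And>r. r \<ge> 0 \<Longrightarrow> u r x = T n r * c"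
  shows "dt u t x = T (Suc n) t * c" and "(\<lambda>r. u r x) differentiable (at t within {0..})"
proof -
  have "((\<lambda>r. T n r * c) has_real_derivative T (Suc n) t * c) (at t)"
    using assms(1) unfolding tower_def by (auto intro!: derivative_eq_intros)
  then show "dt u t x = T (Suc n) t * c" "(\<lambda>r. u r x) differentiable (at t within {0..})"
    using dt_eqI[where u = u and x = x, OF assms(2)] assms(3) by metis+
qed

text \<open>Agreement is required only for \<open>t \<ge> 0\<close> on the beam: the iterated one-sided derivatives
  have no determined values elsewhere, and the induction passes to such derivatives.\<close>

lemma Ck_separated:
  assumes "L > 0" "tower T" "tower X"
    and "\<And>t x. t \<ge> 0 \<Longrightarrow> x \<in> {0..L} \<Longrightarrow> u t x = T a t * X b x"
  shows "Ck L k u"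
  using assms(4)
proof (induction k arbitrary: u a b)
  case (0 u a b)
  have "continuous_on ({0..} \<times> {0..L}) (\<lambda>(t, x). T a t * X b x)"
    unfolding case_prod_beta
    by (intro continuous_intros continuous_on_compose2[OF tower_continuous[OF assms(2)]]
        continuous_on_compose2[OF tower_continuous[OF assms(3)]]) (auto simp: subset_UNIV)
  then show ?case
    by (simp, elim continuous_on_eq) (use 0 in auto)
next
  case (Suc k u a b)
  have "continuous_on ({0..} \<times> {0..L}) (\<lambda>(t, x). u t x)"
    using Suc.IH[OF Suc.prems] by (cases k) auto
  moreover have "u t differentiable (at x within {0..L})"
    "(\<lambda>r. u r x) differentiable (at t within {0..})"
    if "t \<ge> 0" "x \<in> {0..L}" for t x
    using D_tower(2)[OF assms(1,3) that(2), of "u t"] dt_tower(2)[OF assms(2) that(1), of u x]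
      Suc.prems that by blast+
  moreover have "Ck L k (\<lambda>t. D L (u t))"
    by (rule Suc.IH[of _ a "Suc b"]) (use D_tower(1)[OF assms(1,3)] Suc.prems in blast)
  moreover have "Ck L k (dt u)"
    by (rule Suc.IH[of _ "Suc a" b]) (use dt_tower(1)[OF assms(2)] Suc.prems in blast)
  ultimately show ?case by simp
qed

lemma continuous_in_L2:
  assumes "continuous_on {0..L} f"
  shows "f \<in> L2 L"
  unfolding L2_def
  using assms
  by (auto intro!: continuous_imp_measurable_on_sets_lebesgue continuous_imp_integrable_real
      continuous_intros)

lemma tower_in_H1_left:
  assumes "tower X" "X 0 0 = 0"
  shows "(\<lambda>x. c * X 0 x) \<in> H1_left L"
  unfolding H1_left_def
proof (intro CollectI bexI ballI)
  show "(\<lambda>x. c * X (Suc 0) x) \<in> L2 L"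
    by (intro continuous_in_L2 continuous_intros tower_continuous assms)
  fix x assume "x \<in> {0..L}"
  then have "((\<lambda>x. c * X (Suc 0) x) has_integral c * X 0 x - c * X 0 0) {0..x}"
    using assms unfolding tower_def
    by (intro fundamental_theorem_of_calculus)
      (auto intro!: derivative_eq_intros intro: has_field_derivative_at_within
        simp flip: has_real_derivative_iff_has_vector_derivative)
  then show "c * X 0 x = integral {0..x} (\<lambda>x. c * X (Suc 0) x)"
    using assms(2) by (simp only: integral_unique mult_zero_right diff_zero)
qed

lemma zero_in_H1_left: "(\<lambda>x. 0) \<in> H1_left L"
  unfolding H1_left_def by (auto intro!: bexI[of _ "\<lambda>x. 0"] continuous_in_L2)

lemma zero_in_H2_left: "(\<lambda>x. 0) \<in> H2_left L"
  unfolding H2_left_def by (auto intro!: bexI[of _ "\<lambda>x. 0"] zero_in_H1_left)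

lemma D_zero: "L > 0 \<Longrightarrow> x \<in> {0..L} \<Longrightarrow> (\<And>y. y \<in> {0..L} \<Longrightarrow> f y = 0) \<Longrightarrow> D L f x = 0"
  by (rule D_eqI(1)[of L x f "\<lambda>y. 0"]) auto

lemma dt_zero: "t \<ge> 0 \<Longrightarrow> (\<And>r. r \<ge> 0 \<Longrightarrow> u r x = 0) \<Longrightarrow> dt u t x = 0"
  by (rule dt_eqI(1)[of t u x "\<lambda>y. 0"]) auto

section \<open>Undamped standing waves\<close>

context acl_beam
begin

text \<open>The clause \<open>P 0 L = 0\<close> is the one that silences the voltage feedback; it overdetermines the
  eigenvalue problem for \<open>(V, P)\<close>.\<close>

definition undamped_profiles :: "real \<Rightarrow> (nat \<Rightarrow> real \<Rightarrow> real) \<Rightarrow> (nat \<Rightarrow> real \<Rightarrow> real) \<Rightarrow> bool" where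
  "undamped_profiles \<omega> V P \<longleftrightarrow> tower V \<and> tower P \<and>
     V 0 0 = 0 \<and> P 0 0 = 0 \<and> V 1 L = 0 \<and> P 1 L = 0 \<and> P 0 L = 0 \<and>
     (\<forall>i\<in>{1,3}. \<forall>x.
        \<rho> i * \<omega>\<^sup>2 * V 0 x + \<alpha> i * V 2 x - \<gamma> i * \<beta> i * P 2 x = 0 \<and>
        \<mu> i * \<omega>\<^sup>2 * P 0 x + \<beta> i * P 2 x - \<gamma> i * \<beta> i * V 2 x = 0)"

definition standing_wave :: "real \<Rightarrow> (nat \<Rightarrow> real \<Rightarrow> real) \<Rightarrow> nat \<Rightarrow> real \<Rightarrow> real \<Rightarrow> real" where
  "standing_wave \<omega> X i t x = sin_tower \<omega> 0 t * X 0 x"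

lemma dt_standing_wave:
  "t \<ge> 0 \<Longrightarrow> dt (standing_wave \<omega> X i) t x = sin_tower \<omega> (Suc 0) t * X 0 x"
  by (rule dt_tower(1)[OF tower_sin]) (auto simp: standing_wave_def)

lemma dt_dt_standing_wave:
  "t \<ge> 0 \<Longrightarrow> dt (dt (standing_wave \<omega> X i)) t x = sin_tower \<omega> (Suc (Suc 0)) t * X 0 x"
  by (rule dt_tower(1)[OF tower_sin]) (auto simp: dt_standing_wave)

lemma D_standing_wave:
  "tower X \<Longrightarrow> x \<in> {0..L} \<Longrightarrow> D L (standing_wave \<omega> X i t) x = sin_tower \<omega> 0 t * X (Suc 0) x"
  by (rule D_tower(1)[OF L_pos]) (auto simp: standing_wave_def)

lemma D_D_standing_wave:
  "tower X \<Longrightarrow> x \<in> {0..L} \<Longrightarrow>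
    D L (D L (standing_wave \<omega> X i t)) x = sin_tower \<omega> 0 t * X (Suc (Suc 0)) x"
  by (rule D_tower(1)[OF L_pos]) (auto simp: D_standing_wave)

lemma no_shear:
  assumes "x \<in> {0..L}"
  shows "\<phi> (\<lambda>j. standing_wave \<omega> V j t) (\<lambda>x. 0) x = 0"
  using assms by (simp add: \<phi>_def D_zero[OF L_pos] standing_wave_def)

lemma undamped_classical_solution:
  assumes "undamped_profiles \<omega> V P"
  shows "classical_solution s k\<^sub>1 k\<^sub>2 (standing_wave \<omega> V) (standing_wave \<omega> P) (\<lambda>t x. 0)"
proof -
  have V: "tower V" "V 0 0 = 0" "V (Suc 0) L = 0"
    and P: "tower P" "P 0 0 = 0" "P (Suc 0) L = 0" "P 0 L = 0"
    and eqs: "\<And>i x. i \<in> {1,3} \<Longrightarrow>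
        \<rho> i * \<omega>\<^sup>2 * V 0 x + \<alpha> i * V (Suc (Suc 0)) x - \<gamma> i * \<beta> i * P (Suc (Suc 0)) x = 0"
      "\<And>i x. i \<in> {1,3} \<Longrightarrow>
        \<mu> i * \<omega>\<^sup>2 * P 0 x + \<beta> i * P (Suc (Suc 0)) x - \<gamma> i * \<beta> i * V (Suc (Suc 0)) x = 0"
    using assms unfolding undamped_profiles_def numeral_2_eq_2 One_nat_def by blast+
  have Ck: "Ck L k (standing_wave \<omega> X i)" if "tower X" for X k i
    by (rule Ck_separated[OF L_pos tower_sin that]) (simp add: standing_wave_def)
  have Ckw: "Ck L k (\<lambda>t x. 0)" for k
    by (rule Ck_separated[OF L_pos tower_sin tower_sin[of 0], of _ _ 0 0]) (simp add: sin_tower_def)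
  have w: "dt (\<lambda>t x. 0) t x = 0" "dt (dt (\<lambda>t x. 0)) t x = 0" if "t \<ge> 0" for t x
    using that by (auto intro!: dt_zero)
  have Dw: "D L (\<lambda>x. 0) x = 0" "D L (D L (\<lambda>x. 0)) x = 0" "D L (D L (D L (\<lambda>x. 0))) x = 0"
    "D L (D L (D L (D L (\<lambda>x. 0)))) x = 0" if "x \<in> {0..L}" for x
    using that by (auto intro!: D_zero[OF L_pos])
  have Dw': "D L (dt (\<lambda>t x. 0) t) x = 0"
    "D L (dt (dt (\<lambda>t x. 0)) t) x = 0" "D L (D L (dt (dt (\<lambda>t x. 0)) t)) x = 0"
    if "t \<ge> 0" "x \<in> {0..L}" for t x
    using that by (auto intro!: D_zero[OF L_pos] simp: w)
  have D\<phi>: "D L (\<phi> (\<lambda>j. standing_wave \<omega> V j t) (\<lambda>x. 0)) x = 0" if "x \<in> {0..L}" for t x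
    using that by (auto intro!: D_zero[OF L_pos] simp: no_shear)
  have eq1: "\<rho> i * h i * dt (dt (standing_wave \<omega> V i)) t x
      - \<alpha> i * h i * D L (D L (standing_wave \<omega> V i t)) x
      + \<gamma> i * \<beta> i * h i * D L (D L (standing_wave \<omega> P i t)) x = 0"
    if "i \<in> {1,3}" "t > 0" "x \<in> {0..L}" for i t x
  proof -
    have "\<rho> i * h i * dt (dt (standing_wave \<omega> V i)) t x
      - \<alpha> i * h i * D L (D L (standing_wave \<omega> V i t)) x
      + \<gamma> i * \<beta> i * h i * D L (D L (standing_wave \<omega> P i t)) x
      = - (h i * sin (\<omega> * t)) * (\<rho> i * \<omega>\<^sup>2 * V 0 x + \<alpha> i * V (Suc (Suc 0)) x
          - \<gamma> i * \<beta> i * P (Suc (Suc 0)) x)"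
      using that by (simp add: dt_dt_standing_wave D_D_standing_wave V P sin_tower_0 sin_tower_2
          algebra_simps)
    then show ?thesis using eqs(1)[OF that(1)] by simp
  qed
  have eq2: "\<mu> i * h i * dt (dt (standing_wave \<omega> P i)) t x
      - \<beta> i * h i * D L (D L (standing_wave \<omega> P i t)) x
      + \<gamma> i * \<beta> i * h i * D L (D L (standing_wave \<omega> V i t)) x = 0"
    if "i \<in> {1,3}" "t > 0" "x \<in> {0..L}" for i t x
  proof -
    have "\<mu> i * h i * dt (dt (standing_wave \<omega> P i)) t x
      - \<beta> i * h i * D L (D L (standing_wave \<omega> P i t)) x
      + \<gamma> i * \<beta> i * h i * D L (D L (standing_wave \<omega> V i t)) x
      = - (h i * sin (\<omega> * t)) * (\<mu> i * \<omega>\<^sup>2 * P 0 x + \<beta> i * P (Suc (Suc 0)) x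
          - \<gamma> i * \<beta> i * V (Suc (Suc 0)) x)"
      using that by (simp add: dt_dt_standing_wave D_D_standing_wave V P sin_tower_0 sin_tower_2
          algebra_simps)
    then show ?thesis using eqs(2)[OF that(1)] by simp
  qed
  have ends: "standing_wave \<omega> V i t 0 = 0" "standing_wave \<omega> P i t 0 = 0"
    "D L (standing_wave \<omega> V i t) L = 0" "D L (standing_wave \<omega> P i t) L = 0"
    "t > 0 \<Longrightarrow> dt (standing_wave \<omega> P i) t L = 0" for i t
    using L_pos by (simp_all add: D_standing_wave dt_standing_wave V P)
      (simp_all add: standing_wave_def V P)
  show ?thesis
    unfolding classical_solution_def solves_system_def
    using L_pos
    by (intro conjI ballI allI impI)
      (simp_all add: Ck Ckw V(1) P(1) ends w Dw Dw' D\<phi> no_shear eq1 eq2 del: insert_iff)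
qed

abbreviation wave_state :: "real \<Rightarrow> (nat \<Rightarrow> real \<Rightarrow> real) \<Rightarrow> (nat \<Rightarrow> real \<Rightarrow> real) \<Rightarrow> real \<Rightarrow> state" where
  "wave_state \<omega> V P \<equiv> state_at (standing_wave \<omega> V) (standing_wave \<omega> P) (\<lambda>t x. 0)"

lemma wave_state_in_energy_space:
  assumes "undamped_profiles \<omega> V P" "t \<ge> 0"
  shows "wave_state \<omega> V P t \<in> energy_space L"
proof -
  have V: "tower V" "V 0 0 = 0" and P: "tower P" "P 0 0 = 0"
    using assms by (simp_all add: undamped_profiles_def)
  have "standing_wave \<omega> X i t = (\<lambda>x. sin_tower \<omega> 0 t * X 0 x)"
    "dt (standing_wave \<omega> X i) t = (\<lambda>x. sin_tower \<omega> (Suc 0) t * X 0 x)" for X i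
    using assms(2) by (auto simp: standing_wave_def dt_standing_wave)
  moreover have "dt (\<lambda>t x. 0) t = (\<lambda>x. 0)"
    using assms(2) by (auto intro!: dt_zero)
  ultimately show ?thesis
    using tower_continuous[OF V(1)] tower_continuous[OF P(1)]
    by (auto simp: energy_space_def state_at_def zero_in_H1_left zero_in_H2_left
        intro!: tower_in_H1_left V P continuous_in_L2 continuous_on_mult_left)
qed

lemma energy_state_diff_self: "energy (state_diff S S) = 0"
proof -
  have D0: "D L (\<lambda>x. 0) x = 0" "D L (D L (\<lambda>x. 0)) x = 0" if "x \<in> {0..L}" for x
    using that by (auto intro!: D_zero[OF L_pos])
  have "(\<integral>x. F x \<partial>lebesgue_on {0..L}) = (\<integral>x. (0::real) \<partial>lebesgue_on {0..L})"
    if "\<And>x. x \<in> {0..L} \<Longrightarrow> F x = 0" for F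
    using that by (intro Bochner_Integration.integral_cong) auto
  then show ?thesis
    unfolding energy_def state_diff_def by (simp add: D0 \<phi>_def)
qed

text \<open>At times when \<open>sin (\<omega> t) = 0\<close> and \<open>cos (\<omega> t) = 1\<close> all the energy is kinetic, which spares
  computing the potential part.\<close>

lemma wave_energy_full_period:
  assumes "t \<ge> 0" "sin (\<omega> * t) = 0" "cos (\<omega> * t) = 1"
  shows "energy (wave_state \<omega> V P t) = 1 / 2 * (\<integral>x.
    (\<Sum>i\<in>{1,3}. h i * (\<rho> i * (\<omega> * V 0 x)\<^sup>2 + \<mu> i * (\<omega> * P 0 x)\<^sup>2)) \<partial>lebesgue_on {0..L})"
proof -
  have eq: "standing_wave \<omega> X i t = (\<lambda>x. 0)"
    "dt (standing_wave \<omega> X i) t = (\<lambda>x. \<omega> * X 0 x)" for X i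
    using assms by (auto simp: standing_wave_def dt_standing_wave sin_tower_0 sin_tower_1)
  have w: "dt (\<lambda>t x. 0) t = (\<lambda>x. 0)"
    using assms by (auto intro!: dt_zero)
  have D0: "D L (\<lambda>x. 0) x = 0" "D L (D L (\<lambda>x. 0)) x = 0" if "x \<in> {0..L}" for x
    using that by (auto intro!: D_zero[OF L_pos])
  show ?thesis
    unfolding energy_def state_at_def
    by (intro arg_cong[where f = "\<lambda>x. 1 / 2 * x"] Bochner_Integration.integral_cong refl)
      (simp add: eq w D0 \<phi>_def)
qed

lemma kinetic_integral_pos:
  assumes "tower V" "tower P" "V 0 L \<noteq> 0" "\<omega> \<noteq> 0"
  shows "(\<integral>x. (\<Sum>i\<in>{1,3}. h i * (\<rho> i * (\<omega> * V 0 x)\<^sup>2 + \<mu> i * (\<omega> * P 0 x)\<^sup>2))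
    \<partial>lebesgue_on {0..L}) > 0" (is "integral\<^sup>L _ ?F > 0")
proof -
  have pos: "h i * \<rho> i > 0" "h i * \<mu> i > 0" if "i \<in> {1,3}" for i
    using that h_pos \<rho>_pos piezo[OF that] by auto
  have F: "?F x = (\<Sum>i\<in>{1,3}. h i * \<rho> i * (\<omega> * V 0 x)\<^sup>2 + h i * \<mu> i * (\<omega> * P 0 x)\<^sup>2)" for x
    by (intro sum.cong) (auto simp: algebra_simps)
  have nonneg: "?F x \<ge> 0" for x
  proof (unfold F, rule sum_nonneg)
    fix i :: nat assume "i \<in> {1,3}"
    then have "0 \<le> h i * \<rho> i" "0 \<le> h i * \<mu> i" using pos less_imp_le by metis+
    then show "0 \<le> h i * \<rho> i * (\<omega> * V 0 x)\<^sup>2 + h i * \<mu> i * (\<omega> * P 0 x)\<^sup>2"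
      by (simp only: add_nonneg_nonneg mult_nonneg_nonneg zero_le_power2)
  qed
  have cont: "continuous_on {0..L} ?F"
    by (intro continuous_intros tower_continuous assms)
  have "?F L > 0"
  proof -
    have "h 1 * \<rho> 1 * (\<omega> * V 0 L)\<^sup>2 > 0" "h 1 * \<mu> 1 * (\<omega> * P 0 L)\<^sup>2 \<ge> 0"
      "h 3 * \<rho> 3 * (\<omega> * V 0 L)\<^sup>2 \<ge> 0" "h 3 * \<mu> 3 * (\<omega> * P 0 L)\<^sup>2 \<ge> 0"
      using pos[of 1] pos[of 3] assms(3,4) by auto
    then show ?thesis unfolding F by simp
  qed
  then have "integral\<^sup>L (lebesgue_on {0..L}) ?F \<noteq> 0"
    using integralL_eq_0_iff[OF cont L_pos nonneg] L_pos by force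
  moreover have "integral\<^sup>L (lebesgue_on {0..L}) ?F \<ge> 0"
    using nonneg by (intro Bochner_Integration.integral_nonneg)
  ultimately show ?thesis by linarith
qed

lemma undamped_wave_not_stable:
  assumes prof: "undamped_profiles \<omega> V P" and "V 0 L \<noteq> 0" "\<omega> > 0"
  shows "\<not> strongly_stable s k\<^sub>1 k\<^sub>2"
proof
  assume "strongly_stable s k\<^sub>1 k\<^sub>2"
  moreover have "finite_energy_solution s k\<^sub>1 k\<^sub>2 (wave_state \<omega> V P)"
    unfolding finite_energy_solution_def
  proof (intro conjI exI allI impI)
    show "wave_state \<omega> V P t \<in> energy_space L" if "t \<ge> 0" for t
      using wave_state_in_energy_space[OF prof that] .
    show "classical_solution s k\<^sub>1 k\<^sub>2 (standing_wave \<omega> V) (standing_wave \<omega> P) (\<lambda>t x. 0)" for n :: nat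
      using undamped_classical_solution[OF prof] .
    show "uniform_limit {0..T} (\<lambda>n t. energy (state_diff (wave_state \<omega> V P t) (wave_state \<omega> V P t)))
      (\<lambda>t. 0) sequentially" for T
      by (simp add: energy_state_diff_self uniform_limit_const)
  qed
  ultimately have lim: "((\<lambda>t. energy (wave_state \<omega> V P t)) \<longlongrightarrow> 0) at_top"
    unfolding strongly_stable_def using wave_state_in_energy_space[OF prof, of 0] by blast
  define \<tau> where "\<tau> n = 2 * pi / \<omega> * real n" for n :: nat
  define E where "E = 1 / 2 * (\<integral>x.
    (\<Sum>i\<in>{1,3}. h i * (\<rho> i * (\<omega> * V 0 x)\<^sup>2 + \<mu> i * (\<omega> * P 0 x)\<^sup>2)) \<partial>lebesgue_on {0..L})"
  have "E > 0"
    using kinetic_integral_pos[of V P \<omega>] assms by (simp add: E_def undamped_profiles_def)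
  have "filterlim \<tau> at_top sequentially"
    unfolding \<tau>_def using \<open>\<omega> > 0\<close>
    by (intro filterlim_tendsto_pos_mult_at_top[OF tendsto_const] filterlim_real_sequentially) simp
  then have "(\<lambda>n. energy (wave_state \<omega> V P (\<tau> n))) \<longlonglongrightarrow> 0"
    by (rule filterlim_compose[OF lim])
  moreover have "energy (wave_state \<omega> V P (\<tau> n)) = E" for n
  proof -
    have "\<omega> * \<tau> n = 2 * real n * pi" "\<tau> n \<ge> 0"
      using \<open>\<omega> > 0\<close> by (simp_all add: \<tau>_def)
    then show ?thesis
      unfolding E_def by (intro wave_energy_full_period) (simp_all only: sin_2npi cos_2npi)
  qed
  ultimately show False
    using \<open>E > 0\<close> by (simp add: LIMSEQ_const_iff)
qed

section \<open>The two families of sine waves\<close>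

text \<open>The numbers \<open>\<zeta>\<^sub>\<plusminus>\<^sup>2\<close> are the two roots of one quadratic; its discriminant is positive because
  \<open>(a + b + c)\<^sup>2 - 4 a b \<ge> c\<^sup>2 + 2 c (a + b)\<close> with \<open>c = \<gamma>\<^sup>2 \<mu> / \<alpha>\<^sub>1 > 0\<close>. Multiplied out, the
  quadratic is the solvability condition of the amplitude equations.\<close>

lemma \<zeta>_facts:
  assumes i: "i \<in> {1,3}"
  shows \<zeta>_minus_pos: "\<zeta>_minus i > 0" and \<zeta>_minus_less_plus: "\<zeta>_minus i < \<zeta>_plus i"
    and dispersion_plus:
      "(\<alpha> i - \<rho> i / (\<zeta>_plus i)\<^sup>2) * (\<beta> i - \<mu> i / (\<zeta>_plus i)\<^sup>2) = (\<gamma> i * \<beta> i)\<^sup>2"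
    and dispersion_minus:
      "(\<alpha> i - \<rho> i / (\<zeta>_minus i)\<^sup>2) * (\<beta> i - \<mu> i / (\<zeta>_minus i)\<^sup>2) = (\<gamma> i * \<beta> i)\<^sup>2"
proof -
  have pos: "\<alpha>\<^sub>1 i > 0" "\<beta> i > 0" "\<mu> i > 0" "\<gamma> i \<noteq> 0" "\<rho> i > 0"
    using piezo[OF i] \<rho>_pos i by auto
  define a b c where "a = \<mu> i / \<beta> i" and "b = \<rho> i / \<alpha>\<^sub>1 i" and "c = (\<gamma> i)\<^sup>2 * \<mu> i / \<alpha>\<^sub>1 i"
  have abc: "a > 0" "b > 0" "c > 0"
    using pos by (simp_all add: a_def b_def c_def)
  define S where "S = \<zeta>_sum i"
  define \<Delta> where "\<Delta> = S\<^sup>2 - 4 * \<rho> i * \<mu> i / (\<beta> i * \<alpha>\<^sub>1 i)"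
  have S: "S = a + b + c" by (simp add: S_def \<zeta>_sum_def a_def b_def c_def)
  have \<Delta>: "\<Delta> = S\<^sup>2 - 4 * a * b" by (simp add: \<Delta>_def a_def b_def)
  have "\<Delta> = (a - b)\<^sup>2 + c * (c + 2 * (a + b))"
    unfolding \<Delta> S by (simp add: power2_eq_square algebra_simps)
  then have "\<Delta> > 0" using abc by (simp add: add_nonneg_pos)
  have "sqrt \<Delta> < S"
    using abc by (intro real_less_lsqrt) (auto simp: \<Delta> S)
  have zp: "\<zeta>_plus i = sqrt ((S + sqrt \<Delta>) / 2)" and zm: "\<zeta>_minus i = sqrt ((S - sqrt \<Delta>) / 2)"
    by (simp_all add: \<zeta>_plus_def \<zeta>_minus_def S_def \<Delta>_def real_sqrt_divide)
  show "\<zeta>_minus i > 0" "\<zeta>_minus i < \<zeta>_plus i"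
    using \<open>sqrt \<Delta> < S\<close> \<open>\<Delta> > 0\<close> by (simp_all add: zp zm)
  have root: "(\<alpha> i - \<rho> i / z) * (\<beta> i - \<mu> i / z) = (\<gamma> i * \<beta> i)\<^sup>2"
    if "z > 0" "z\<^sup>2 - S * z + a * b = 0" for z
  proof -
    have "(\<alpha> i * z - \<rho> i) * (\<beta> i * z - \<mu> i) - (\<gamma> i * \<beta> i)\<^sup>2 * z\<^sup>2
        = \<alpha>\<^sub>1 i * \<beta> i * (z\<^sup>2 - S * z + a * b)"
      unfolding S a_def b_def c_def \<alpha>_def using pos
      by (simp add: field_simps power2_eq_square)
    then have "(\<alpha> i * z - \<rho> i) * (\<beta> i * z - \<mu> i) = (\<gamma> i * \<beta> i)\<^sup>2 * z\<^sup>2"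
      unfolding that(2) by simp
    moreover have "\<alpha> i - \<rho> i / z = (\<alpha> i * z - \<rho> i) / z" "\<beta> i - \<mu> i / z = (\<beta> i * z - \<mu> i) / z"
      using that(1) by (simp_all add: field_simps)
    ultimately show ?thesis
      using that(1) by (simp add: power2_eq_square)
  qed
  have sq: "(sqrt \<Delta>)\<^sup>2 = \<Delta>" using \<open>\<Delta> > 0\<close> by simp
  have "((S + sqrt \<Delta>) / 2)\<^sup>2 - S * ((S + sqrt \<Delta>) / 2) + a * b = 0"
    "((S - sqrt \<Delta>) / 2)\<^sup>2 - S * ((S - sqrt \<Delta>) / 2) + a * b = 0"
    using sq \<Delta> by (simp_all add: power2_eq_square field_simps)
  moreover have half_pos: "(S + sqrt \<Delta>) / 2 > 0" "(S - sqrt \<Delta>) / 2 > 0"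
    using \<open>sqrt \<Delta> < S\<close> \<open>\<Delta> > 0\<close> abc by (simp_all add: S add_pos_pos)
  moreover have "(\<zeta>_plus i)\<^sup>2 = (S + sqrt \<Delta>) / 2" "(\<zeta>_minus i)\<^sup>2 = (S - sqrt \<Delta>) / 2"
    unfolding zp zm by (rule real_sqrt_pow2[OF less_imp_le[OF half_pos(1)]]
      real_sqrt_pow2[OF less_imp_le[OF half_pos(2)]])+
  ultimately show "(\<alpha> i - \<rho> i / (\<zeta>_plus i)\<^sup>2) * (\<beta> i - \<mu> i / (\<zeta>_plus i)\<^sup>2) = (\<gamma> i * \<beta> i)\<^sup>2"
    "(\<alpha> i - \<rho> i / (\<zeta>_minus i)\<^sup>2) * (\<beta> i - \<mu> i / (\<zeta>_minus i)\<^sup>2) = (\<gamma> i * \<beta> i)\<^sup>2"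
    by (simp_all only: root)
qed

end

lemma cos_odd_quarter_turn: "cos ((2 * real n - 1) * (pi / 2)) = 0"
proof -
  have "(2 * real n - 1) * (pi / 2) = real n * pi - pi / 2" by (simp add: field_simps)
  then show "cos ((2 * real n - 1) * (pi / 2)) = 0"
    by (simp only: cos_diff cos_pi_half sin_npi)
qed

text \<open>If a quarter of the first wavelength fits an odd number of times into \<open>L\<close>, namely
  \<open>2 n - 1\<close> times, then the ratio condition makes a quarter of the second wavelength fit
  \<open>2 m - 1\<close> times.\<close>

lemma common_frequency:
  fixes z\<^sub>1 z\<^sub>2 L :: real and m n :: nat
  assumes "L > 0" "z\<^sub>1 > 0" "z\<^sub>2 > 0" "m \<ge> 1" "n \<ge> 1"
    and "z\<^sub>1 / z\<^sub>2 = (2 * real n - 1) / (2 * real m - 1)"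
  obtains \<omega> where "\<omega> > 0" "cos (\<omega> * z\<^sub>1 * L) = 0" "cos (\<omega> * z\<^sub>2 * L) = 0"
proof
  define \<omega> where "\<omega> = (2 * real n - 1) * (pi / 2) / (L * z\<^sub>1)"
  show "\<omega> > 0" using assms by (simp add: \<omega>_def)
  have "\<omega> * z\<^sub>1 * L = (2 * real n - 1) * (pi / 2)"
    using assms by (simp add: \<omega>_def)
  then show "cos (\<omega> * z\<^sub>1 * L) = 0" by (simp only: cos_odd_quarter_turn)
  have "z\<^sub>1 * (2 * real m - 1) = z\<^sub>2 * (2 * real n - 1)"
    using assms by (simp add: field_simps)
  moreover have "\<omega> * z\<^sub>2 * L = z\<^sub>2 * (2 * real n - 1) * (pi / 2) / z\<^sub>1"
    using assms by (simp add: \<omega>_def)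
  ultimately have "\<omega> * z\<^sub>2 * L = z\<^sub>1 * (2 * real m - 1) * (pi / 2) / z\<^sub>1"
    by (simp only:)
  then have "\<omega> * z\<^sub>2 * L = (2 * real m - 1) * (pi / 2)"
    using assms by simp
  then show "cos (\<omega> * z\<^sub>2 * L) = 0" by (simp only: cos_odd_quarter_turn)
qed

theorem mainTheorem1:
  fixes L G\<^sub>2 k\<^sub>1 k\<^sub>2 :: real
    and h \<rho> \<alpha>\<^sub>1 \<beta> \<gamma> \<mu> s :: "nat \<Rightarrow> real"
  assumes "acl_beam L G\<^sub>2 h \<rho> \<alpha>\<^sub>1 \<beta> \<gamma> \<mu>"
    and "\<alpha>\<^sub>1 1 = \<alpha>\<^sub>1 3" and "\<gamma> 1 = \<gamma> 3" and "\<beta> 1 = \<beta> 3" and "\<mu> 1 = \<mu> 3" and "\<rho> 1 = \<rho> 3"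
    and "s 1 > 0" and "s 3 > 0" and "k\<^sub>1 > 0" and "k\<^sub>2 > 0"
    and "\<exists>m n :: nat \<Rightarrow> nat. \<forall>i\<in>{1,3}. m i \<ge> 1 \<and> n i \<ge> 1 \<and>
           acl_beam.\<zeta>_plus \<rho> \<alpha>\<^sub>1 \<beta> \<gamma> \<mu> i / acl_beam.\<zeta>_minus \<rho> \<alpha>\<^sub>1 \<beta> \<gamma> \<mu> i
             = (2 * real (n i) - 1) / (2 * real (m i) - 1)"
  shows "\<not> acl_beam.strongly_stable L G\<^sub>2 h \<rho> \<alpha>\<^sub>1 \<beta> \<gamma> \<mu> s k\<^sub>1 k\<^sub>2"
proof -
  interpret acl_beam L G\<^sub>2 h \<rho> \<alpha>\<^sub>1 \<beta> \<gamma> \<mu> by fact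
  define z\<^sub>p z\<^sub>m where "z\<^sub>p = \<zeta>_plus 1" and "z\<^sub>m = \<zeta>_minus 1"
  have z: "0 < z\<^sub>m" "z\<^sub>m < z\<^sub>p"
    and disp: "(\<alpha> 1 - \<rho> 1 / z\<^sub>p\<^sup>2) * (\<beta> 1 - \<mu> 1 / z\<^sub>p\<^sup>2) = (\<gamma> 1 * \<beta> 1)\<^sup>2"
      "(\<alpha> 1 - \<rho> 1 / z\<^sub>m\<^sup>2) * (\<beta> 1 - \<mu> 1 / z\<^sub>m\<^sup>2) = (\<gamma> 1 * \<beta> 1)\<^sup>2"
    unfolding z\<^sub>p_def z\<^sub>m_def
    using \<zeta>_minus_pos[of 1] \<zeta>_minus_less_plus[of 1] dispersion_plus[of 1] dispersion_minus[of 1]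
    by simp_all
  obtain m' n' :: nat where "m' \<ge> 1" "n' \<ge> 1" "z\<^sub>p / z\<^sub>m = (2 * real n' - 1) / (2 * real m' - 1)"
    using assms(11) unfolding z\<^sub>p_def z\<^sub>m_def by blast
  then obtain \<omega> where \<omega>: "\<omega> > 0" "cos (\<omega> * z\<^sub>p * L) = 0" "cos (\<omega> * z\<^sub>m * L) = 0"
    using common_frequency[OF L_pos, of z\<^sub>p z\<^sub>m] z by (metis less_trans)
  define A where "A z = \<beta> 1 - \<mu> 1 / z\<^sup>2" for z
  define e where "e z = sin (\<omega> * z * L)" for z
  \<comment> \<open>The factors \<open>e z = \<plusminus>1\<close> make both sine waves equal to \<open>1\<close> at the end \<open>x = L\<close>, so that their
    difference cancels there in \<open>P\<close>.\<close>
  define V where "V n x = A z\<^sub>p * e z\<^sub>p * sin_tower (\<omega> * z\<^sub>p) n x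
    + (- A z\<^sub>m * e z\<^sub>m) * sin_tower (\<omega> * z\<^sub>m) n x" for n x
  define P where "P n x = \<gamma> 1 * \<beta> 1 * e z\<^sub>p * sin_tower (\<omega> * z\<^sub>p) n x
    + (- \<gamma> 1 * \<beta> 1 * e z\<^sub>m) * sin_tower (\<omega> * z\<^sub>m) n x" for n x
  have e: "e z\<^sub>p * sin (\<omega> * z\<^sub>p * L) = 1" "e z\<^sub>m * sin (\<omega> * z\<^sub>m * L) = 1"
    using \<omega> sin_cos_squared_add[of "\<omega> * z\<^sub>p * L"] sin_cos_squared_add[of "\<omega> * z\<^sub>m * L"]
    by (simp_all add: e_def power2_eq_square)
  have "V 0 L = A z\<^sub>p * (e z\<^sub>p * sin (\<omega> * z\<^sub>p * L)) - A z\<^sub>m * (e z\<^sub>m * sin (\<omega> * z\<^sub>m * L))"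
    by (simp add: V_def sin_tower_0)
  then have VL: "V 0 L = \<mu> 1 * (1 / z\<^sub>m\<^sup>2 - 1 / z\<^sub>p\<^sup>2)"
    unfolding e by (simp add: A_def algebra_simps)
  moreover have "1 / z\<^sub>p\<^sup>2 < 1 / z\<^sub>m\<^sup>2"
    using z by (intro divide_strict_left_mono power_strict_mono) auto
  ultimately have "V 0 L > 0" using piezo[of 1] by (simp del: One_nat_def)
  then have "V 0 L \<noteq> 0" by simp
  have "P 0 L = \<gamma> 1 * \<beta> 1 * (e z\<^sub>p * sin (\<omega> * z\<^sub>p * L)) - \<gamma> 1 * \<beta> 1 * (e z\<^sub>m * sin (\<omega> * z\<^sub>m * L))"
    by (simp add: P_def sin_tower_0)
  then have PL: "P 0 L = 0" unfolding e by simp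
  have tower: "tower V" "tower P"
    unfolding V_def P_def by (intro tower_combination tower_sin)+
  have ends: "V 0 0 = 0" "P 0 0 = 0" "V 1 L = 0" "P 1 L = 0"
    using \<omega> by (simp_all add: V_def P_def sin_tower_0 sin_tower_1)
  \<comment> \<open>The amplitude \<open>(A z, \<gamma> \<beta>)\<close> is chosen to solve the second equation; the first one is then
    the dispersion relation.\<close>
  have amp: "\<rho> 1 * A z = z\<^sup>2 * (\<alpha> 1 * A z - (\<gamma> 1 * \<beta> 1)\<^sup>2)"
      "\<mu> 1 = z\<^sup>2 * (\<beta> 1 - A z)"
    if "z > 0" "(\<alpha> 1 - \<rho> 1 / z\<^sup>2) * (\<beta> 1 - \<mu> 1 / z\<^sup>2) = (\<gamma> 1 * \<beta> 1)\<^sup>2" for z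
  proof -
    show "\<rho> 1 * A z = z\<^sup>2 * (\<alpha> 1 * A z - (\<gamma> 1 * \<beta> 1)\<^sup>2)"
      unfolding that(2)[symmetric] A_def[symmetric] using that(1) by (simp add: field_simps)
    show "\<mu> 1 = z\<^sup>2 * (\<beta> 1 - A z)"
      using that(1) by (simp add: A_def)
  qed
  have zp: "0 < z\<^sub>p" using z by simp
  have eq1: "\<rho> 1 * \<omega>\<^sup>2 * V 0 x + \<alpha> 1 * V 2 x - \<gamma> 1 * \<beta> 1 * P 2 x = 0" for x
  proof -
    have "\<rho> 1 * \<omega>\<^sup>2 * V 0 x + \<alpha> 1 * V 2 x - \<gamma> 1 * \<beta> 1 * P 2 x
      = \<omega>\<^sup>2 * e z\<^sub>p * sin (\<omega> * z\<^sub>p * x) * (\<rho> 1 * A z\<^sub>p - z\<^sub>p\<^sup>2 * (\<alpha> 1 * A z\<^sub>p - (\<gamma> 1 * \<beta> 1)\<^sup>2))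
      - \<omega>\<^sup>2 * e z\<^sub>m * sin (\<omega> * z\<^sub>m * x) * (\<rho> 1 * A z\<^sub>m - z\<^sub>m\<^sup>2 * (\<alpha> 1 * A z\<^sub>m - (\<gamma> 1 * \<beta> 1)\<^sup>2))"
      unfolding V_def P_def numeral_2_eq_2 sin_tower_0 sin_tower_2
      by (simp add: algebra_simps power2_eq_square)
    then show ?thesis using amp(1)[OF zp disp(1)] amp(1)[OF z(1) disp(2)] by simp
  qed
  have eq2: "\<mu> 1 * \<omega>\<^sup>2 * P 0 x + \<beta> 1 * P 2 x - \<gamma> 1 * \<beta> 1 * V 2 x = 0" for x
  proof -
    have "\<mu> 1 * \<omega>\<^sup>2 * P 0 x + \<beta> 1 * P 2 x - \<gamma> 1 * \<beta> 1 * V 2 x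
      = \<gamma> 1 * \<beta> 1 * \<omega>\<^sup>2 * (e z\<^sub>p * sin (\<omega> * z\<^sub>p * x) * (\<mu> 1 - z\<^sub>p\<^sup>2 * (\<beta> 1 - A z\<^sub>p))
        - e z\<^sub>m * sin (\<omega> * z\<^sub>m * x) * (\<mu> 1 - z\<^sub>m\<^sup>2 * (\<beta> 1 - A z\<^sub>m)))"
      unfolding V_def P_def numeral_2_eq_2 sin_tower_0 sin_tower_2
      by (simp add: algebra_simps power2_eq_square)
    then show ?thesis using amp(2)[OF zp disp(1)] amp(2)[OF z(1) disp(2)] by simp
  qed
  have "\<alpha> 1 = \<alpha> 3" using assms(2-6) by (simp add: \<alpha>_def)
  then have "undamped_profiles \<omega> V P"
    unfolding undamped_profiles_def
    using tower ends PL eq1 eq2 assms(2-6) by auto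
  then show ?thesis
    using undamped_wave_not_stable \<open>V 0 L \<noteq> 0\<close> \<open>\<omega> > 0\<close> by blast
qed

end
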